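(* The quaternionic scalar-identity ideal $\mathcal I_n^{\mathbb H}=\ker(\rho)$ is generated, as a two-sided $*$-ideal in $\mathbb H\langle\mathbf q,\bar{\mathbf q}\rangle$, by the elements $C_{ij,s}$, $D_{ij,kl}$, $R_i$, i.e. $$\mathcal I_n^{\mathbb H}=\left\langle\{C_{ij,s}\}_{i,j,s}\cup\{D_{ij,kl}\}_{i,j,k,l}\cup\{R_i\}_i\right\rangle_*.$$ Moreover, $\mathbb H\langle\mathbf q,\bar{\mathbf q}\rangle/\mathcal I_n^{\mathbb H}\simeq\mathbb H[x_{11},\dots,x_{n4}]$.
   Context: $\mathbb H$ is the skew field of quaternions with units $\mathbf i,\mathbf j,\mathbf k$. $\mathbb H\langle\mathbf q,\bar{\mathbf q}\rangle$ is the free quaternionic $*$-algebra on letters $q_1,\dots,q_n$ with adjoints $\bar q_i=q_i^*$: it is the real free product of $\mathbb H$ (with conjugation as involution) and the free real $*$-algebra on $q_1,\dots,q_n$; quaternionic constants do not commute with the letters. $\mathbb H[x_{11},\dots,x_{n4}]$ is the polynomial ring in $4n$ commuting central variables $x_{ij}$ ($1\le i\le n$, $1\le j\le4$) with coefficients in $\mathbb H$; its involution fixes the $x_{ij}$ and conjugates coefficients. $\rho:\mathbb H\langle\mathbf q,\bar{\mathbf q}\rangle\to\mathbb H[x_{11},\dots,x_{n4}]$ is the unital $*$-homomorphism fixing $\mathbb H$ with $\rho(q_i)=x_{i1}+x_{i2}\mathbf i+x_{i3}\mathbf j+x_{i4}\mathbf k$ (so $\rho(\bar q_i)=x_{i1}-x_{i2}\mathbf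 i-x_{i3}\mathbf j-x_{i4}\mathbf k$). Write $[a,b]=ab-ba$ (up to sign convention, which does not affect generated ideals). For $i=1,\dots,n$ set $$\chi_{i1}=\tfrac{q_i+\bar q_i}2,\quad\chi_{i2}=\tfrac{\mathbf i\bar q_i-q_i\mathbf i}2,\quad\chi_{i3}=\tfrac{\mathbf j\bar q_i-q_i\mathbf j}2,\quad\chi_{i4}=\tfrac{\mathbf k\bar q_i-q_i\mathbf k}2,$$ $C_{ij,1}=[\chi_{ij},\mathbf i]$, $C_{ij,2}=[\chi_{ij},\mathbf j]$, $C_{ij,3}=[\chi_{ij},\mathbf k]$ for $1\le j\le4$; $D_{ij,kl}=[\chi_{ij},\chi_{kl}]$ for $1\le i,k\le n$, $1\le j,l\le4$; and $R_i=q_i-\chi_{i1}-\chi_{i2}\mathbf i-\chi_{i3}\mathbf j-\chi_{i4}\mathbf k$. $\langle S\rangle_*$ denotes the two-sided $*$-ideal generated by $S$ (smallest two-sided ideal containing $S$ and closed under $*$). *)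

theory Defs
  imports "HOL-Algebra.Algebraic_Closure_Type" "HOL-Algebra.QuotRing" "HOL-Library.Poly_Mapping"
begin

section \<open>Quaternions\<close>

datatype quat = Quat (qre: real) (qi: real) (qj: real) (qk: real)

lemma quat_eq_iff: "x = y \<longleftrightarrow> qre x = qre y \<and> qi x = qi y \<and> qj x = qj y \<and> qk x = qk y"
  by (cases x; cases y) auto

instantiation quat :: "{division_ring, real_algebra_1}"
begin

definition "0 = Quat 0 0 0 0"
definition "1 = Quat 1 0 0 0"
definition "x + y = Quat (qre x + qre y) (qi x + qi y) (qj x + qj y) (qk x + qk y)"
definition "- x = Quat (- qre x) (- qi x) (- qj x) (- qk x)"
definition "x - y = Quat (qre x - qre y) (qi x - qi y) (qj x - qj y) (qk x - qk y)"
definition "r *\<^sub>R x = Quat (r * qre x) (r * qi x) (r * qj x) (r * qk x)"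
definition "x * y = Quat
  (qre x * qre y - qi x * qi y - qj x * qj y - qk x * qk y)
  (qre x * qi y + qi x * qre y + qj x * qk y - qk x * qj y)
  (qre x * qj y - qi x * qk y + qj x * qre y + qk x * qi y)
  (qre x * qk y + qi x * qj y - qj x * qi y + qk x * qre y)"
definition
  "inverse x = (1 / ((qre x)\<^sup>2 + (qi x)\<^sup>2 + (qj x)\<^sup>2 + (qk x)\<^sup>2)) *\<^sub>R
     Quat (qre x) (- qi x) (- qj x) (- qk x)"
definition "x div y = x * inverse y" for x y :: quat

lemmas quat_ops = zero_quat_def one_quat_def plus_quat_def uminus_quat_def minus_quat_def
  scaleR_quat_def times_quat_def

instance
proof
  fix x :: quat
  assume "x \<noteq> 0"
  define N where "N = (qre x)\<^sup>2 + (qi x)\<^sup>2 + (qj x)\<^sup>2 + (qk x)\<^sup>2"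
  have "N \<noteq> 0"
    using \<open>x \<noteq> 0\<close> unfolding N_def quat_eq_iff[of x 0]
    by (simp add: zero_quat_def add_nonneg_eq_0_iff)
  define y where "y = Quat (qre x) (- qi x) (- qj x) (- qk x)"
  have inv: "inverse x = (1 / N) *\<^sub>R y"
    by (simp add: inverse_quat_def y_def N_def)
  have "y * x = N *\<^sub>R 1" "x * y = N *\<^sub>R 1"
    by (simp_all add: y_def N_def quat_ops power2_eq_square)
  moreover have "(1 / N) *\<^sub>R y * x = (1 / N) *\<^sub>R (y * x)"
    "x * (1 / N) *\<^sub>R y = (1 / N) *\<^sub>R (x * y)"
    by (simp_all add: quat_ops add_divide_distrib diff_divide_distrib)
  ultimately show "inverse x * x = 1" "x * inverse x = 1"
    using \<open>N \<noteq> 0\<close> unfolding inv by (simp_all add: quat_ops)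
qed (auto simp: quat_ops divide_quat_def inverse_quat_def algebra_simps)

end

definition qI :: quat where "qI = Quat 0 1 0 0"
definition qJ :: quat where "qJ = Quat 0 0 1 0"
definition qK :: quat where "qK = Quat 0 0 0 1"

definition qcnj :: "quat \<Rightarrow> quat" where
  "qcnj x = Quat (qre x) (- qi x) (- qj x) (- qk x)"

lemma quat_units:
  "qI * qI = -1" "qJ * qJ = -1" "qK * qK = -1"
  "qI * qJ = qK" "qJ * qK = qI" "qK * qI = qJ"
  "qJ * qI = - qK" "qK * qJ = - qI" "qI * qK = - qJ"
  by (simp_all add: qI_def qJ_def qK_def quat_ops)

lemma quat_expand: "x = qre x *\<^sub>R 1 + qi x *\<^sub>R qI + qj x *\<^sub>R qJ + qk x *\<^sub>R qK"
  by (cases x) (simp add: qI_def qJ_def qK_def quat_ops)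

lemma qcnj_simps [simp]:
  "qcnj (x + y) = qcnj x + qcnj y" "qcnj (x - y) = qcnj x - qcnj y" "qcnj (- x) = - qcnj x"
  "qcnj (x * y) = qcnj y * qcnj x" "qcnj (r *\<^sub>R x) = r *\<^sub>R qcnj x"
  "qcnj 0 = 0" "qcnj 1 = 1" "qcnj (qcnj x) = x"
  "qcnj qI = - qI" "qcnj qJ = - qJ" "qcnj qK = - qK"
  by (simp_all add: qcnj_def qI_def qJ_def qK_def quat_ops)

datatype comp = c1 | c2 | c3 | c4



section \<open>Monoid algebras\<close>

text \<open>Words form a monoid under concatenation, so that \<^typ>\<open>'g list \<Rightarrow>\<^sub>0 real\<close> with the
  multiplication of \<^theory>\<open>HOL-Library.Poly_Mapping\<close> is the free real algebra on \<^typ>\<open>'g\<close>.\<close>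

instantiation list :: (type) monoid_add
begin
definition "0 = ([] :: 'a list)"
definition "(xs :: 'a list) + ys = xs @ ys"
instance by standard (simp_all add: zero_list_def plus_list_def)
end

instantiation poly_mapping :: (monoid_add, real_algebra_1) real_algebra_1
begin

lift_definition scaleR_poly_mapping :: "real \<Rightarrow> ('a \<Rightarrow>\<^sub>0 'b) \<Rightarrow> 'a \<Rightarrow>\<^sub>0 'b"
  is "\<lambda>r p k. r *\<^sub>R p k"
  by (erule rev_finite_subset) auto

instance
proof
  fix r :: real and p q :: "'a \<Rightarrow>\<^sub>0 'b"
  have left: "r *\<^sub>R p = Poly_Mapping.single 0 (of_real r) * p" for r and p :: "'a \<Rightarrow>\<^sub>0 'b"
    by (subst mult_map_scale_conv_mult[symmetric], rule poly_mapping_eqI)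
      (simp add: scaleR_poly_mapping.rep_eq map.rep_eq when_def scaleR_conv_of_real)
  have central: "p * Poly_Mapping.single 0 (of_real r) = Poly_Mapping.single 0 (of_real r) * p"
    for r and p :: "'a \<Rightarrow>\<^sub>0 'b"
  proof (induction p rule: update_induct)
    case (update p k c)
    have "Poly_Mapping.update k c p = Poly_Mapping.single k c + p"
      using update(1) by (intro poly_mapping_eqI)
        (auto simp: lookup_update lookup_add lookup_single in_keys_iff)
    then show ?case
      using update(3) by (simp add: algebra_simps mult_single)
        (metis scaleR_conv_of_real mult_scaleR_right mult.right_neutral mult_scaleR_left mult_1)
  qed simp
  show "r *\<^sub>R p * q = r *\<^sub>R (p * q)"
    by (simp add: left mult.assoc)
  show "p * r *\<^sub>R q = r *\<^sub>R (p * q)"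
    unfolding left by (metis central mult.assoc)
qed (rule poly_mapping_eqI, simp add: scaleR_poly_mapping.rep_eq lookup_add algebra_simps)+

end

lemma lookup_scaleR: "Poly_Mapping.lookup (r *\<^sub>R p) k = r *\<^sub>R Poly_Mapping.lookup p k"
  by (simp add: scaleR_poly_mapping.rep_eq)

lemma scaleR_single: "r *\<^sub>R Poly_Mapping.single k c = Poly_Mapping.single k (r *\<^sub>R c)"
  by (rule poly_mapping_eqI) (simp add: lookup_scaleR lookup_single when_def)

lemma poly_mapping_additive_induct [case_names single add]:
  assumes "\<And>k c. P (Poly_Mapping.single k c)" "\<And>p q. P p \<Longrightarrow> P q \<Longrightarrow> P (p + q)"
  shows "P (p :: 'a \<Rightarrow>\<^sub>0 'b::comm_monoid_add)"
proof (induction p rule: update_induct)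
  case const
  show ?case using assms(1)[of undefined 0] by simp
next
  case (update p k c)
  have "Poly_Mapping.update k c p = Poly_Mapping.single k c + p"
    using update(1) by (intro poly_mapping_eqI)
      (auto simp: lookup_update lookup_add lookup_single in_keys_iff)
  then show ?case using assms update(3) by simp
qed

definition eval_words :: "('g \<Rightarrow> 'c::real_algebra_1) \<Rightarrow> ('g list \<Rightarrow>\<^sub>0 real) \<Rightarrow> 'c" where
  "eval_words g p = (\<Sum>w\<in>Poly_Mapping.keys p. Poly_Mapping.lookup p w *\<^sub>R prod_list (map g w))"

lemma eval_words_superset:
  assumes "finite S" "Poly_Mapping.keys p \<subseteq> S"
  shows "eval_words g p = (\<Sum>w\<in>S. Poly_Mapping.lookup p w *\<^sub>R prod_list (map g w))"
  unfolding eval_words_def using assms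
  by (intro sum.mono_neutral_left) (auto simp: in_keys_iff)

lemma eval_words_single [simp]: "eval_words g (Poly_Mapping.single w c) = c *\<^sub>R prod_list (map g w)"
  by (subst eval_words_superset[of "{w}"]) auto

lemma eval_words_add: "eval_words g (p + q) = eval_words g p + eval_words g q"
proof -
  let ?S = "Poly_Mapping.keys p \<union> Poly_Mapping.keys q"
  have "Poly_Mapping.keys (p + q) \<subseteq> ?S" by (rule keys_add)
  then show ?thesis
    using eval_words_superset[of ?S "p + q" g] eval_words_superset[of ?S p g]
      eval_words_superset[of ?S q g]
    by (simp add: lookup_add scaleR_add_left sum.distrib)
qed

lemma eval_words_0 [simp]: "eval_words g 0 = 0"
  by (simp add: eval_words_def)

lemma eval_words_1 [simp]: "eval_words g 1 = 1"
  by (simp add: zero_list_def flip: single_one)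

lemma eval_words_mult: "eval_words g (p * q) = eval_words g p * eval_words g q"
proof (induction p rule: poly_mapping_additive_induct)
  case (single v a)
  show ?case
    by (induction q rule: poly_mapping_additive_induct)
      (simp_all add: mult_single plus_list_def distrib_left eval_words_add)
qed (simp add: distrib_right eval_words_add)

lemma eval_words_minus: "eval_words g (p - q) = eval_words g p - eval_words g q"
  by (metis add_diff_cancel_right' diff_add_cancel eval_words_add)


section \<open>Ideals of type-class rings\<close>

lemma ring_of_type_algebra_sel [simp]:
  "carrier (ring_of_type_algebra :: 'a::ring_1 ring) = UNIV"
  "monoid.mult (ring_of_type_algebra :: 'a ring) = (*)"
  "monoid.one (ring_of_type_algebra :: 'a ring) = 1"
  "ring.zero (ring_of_type_algebra :: 'a ring) = 0"
  "ring.add (ring_of_type_algebra :: 'a ring) = (+)"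
  by (auto simp: ring_of_type_algebra_def fun_eq_iff)

lemma ring_ring_of_type_algebra: "Ring.ring (ring_of_type_algebra :: 'a::ring_1 ring)"
proof -
  have "\<exists>y. y + x = 0 \<and> x + y = 0" for x :: 'a
    by (rule exI[of _ "- x"]) simp
  then show ?thesis
    by unfold_locales (auto simp: algebra_simps Units_def)
qed

lemma ideal_ring_of_type_algebra_iff:
  "ideal I (ring_of_type_algebra :: 'a::ring_1 ring) \<longleftrightarrow>
     0 \<in> I \<and> (\<forall>a\<in>I. \<forall>b\<in>I. a + b \<in> I) \<and> (\<forall>a\<in>I. \<forall>x. x * a \<in> I \<and> a * x \<in> I)"
  (is "?L \<longleftrightarrow> ?R")
proof
  assume ?L
  then interpret ideal I "ring_of_type_algebra :: 'a ring" .
  show ?R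
    using additive_subgroup.zero_closed[OF is_additive_subgroup]
      additive_subgroup.a_closed[OF is_additive_subgroup] I_l_closed I_r_closed by auto
next
  assume R: ?R
  interpret ring "ring_of_type_algebra :: 'a ring" by (rule ring_ring_of_type_algebra)
  show ?L
  proof (rule idealI)
    show "subgroup I (add_monoid (ring_of_type_algebra :: 'a ring))"
    proof (rule add.subgroupI)
      fix a assume "a \<in> I"
      then have "(-1) * a \<in> I" using R by blast
      moreover have "a_inv (ring_of_type_algebra :: 'a ring) a = - a"
        by (rule minus_equality) auto
      ultimately show "\<ominus>\<^bsub>ring_of_type_algebra :: 'a ring\<^esub> a \<in> I"
        by simp
    qed (use R in \<open>auto simp: subset_UNIV\<close>)
  qed (use R in \<open>auto intro: ring_ring_of_type_algebra\<close>)
qed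


section \<open>The free quaternionic *-algebra\<close>

datatype 'n gen = Cst quat | Ltr 'n | LtrS 'n

abbreviation gen_elt :: "'n gen \<Rightarrow> ('n gen list \<Rightarrow>\<^sub>0 real)" where
  "gen_elt g \<equiv> Poly_Mapping.single [g] 1"

inductive_set const_rels :: "('n gen list \<Rightarrow>\<^sub>0 real) set" where
  add: "gen_elt (Cst (a + b)) - (gen_elt (Cst a) + gen_elt (Cst b)) \<in> const_rels"
| mult: "gen_elt (Cst (a * b)) - gen_elt (Cst a) * gen_elt (Cst b) \<in> const_rels"
| scaleR: "gen_elt (Cst (r *\<^sub>R a)) - r *\<^sub>R gen_elt (Cst a) \<in> const_rels"
| one: "gen_elt (Cst 1) - 1 \<in> const_rels"

definition const_ideal :: "('n gen list \<Rightarrow>\<^sub>0 real) set" where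
  "const_ideal = Idl\<^bsub>ring_of_type_algebra\<^esub> const_rels"

lemma ideal_const_ideal: "ideal const_ideal ring_of_type_algebra"
  unfolding const_ideal_def
  by (rule ring.genideal_ideal[OF ring_ring_of_type_algebra]) simp

lemma const_rels_subset: "const_rels \<subseteq> const_ideal"
  unfolding const_ideal_def
  by (rule ring.genideal_self[OF ring_ring_of_type_algebra]) simp

lemma const_ideal_subset:
  "ideal J ring_of_type_algebra \<Longrightarrow> const_rels \<subseteq> J \<Longrightarrow> const_ideal \<subseteq> J"
  unfolding const_ideal_def
  by (rule ring.genideal_minimal[OF ring_ring_of_type_algebra])

lemma const_ideal_closed:
  "0 \<in> const_ideal"
  "a \<in> const_ideal \<Longrightarrow> b \<in> const_ideal \<Longrightarrow> a + b \<in> const_ideal"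
  "a \<in> const_ideal \<Longrightarrow> x * a \<in> const_ideal"
  "a \<in> const_ideal \<Longrightarrow> a * x \<in> const_ideal"
  using ideal_const_ideal[unfolded ideal_ring_of_type_algebra_iff] by blast+

lemma const_ideal_eqI: "p = q \<Longrightarrow> p - q \<in> const_ideal"
  by (simp add: const_ideal_closed(1))

lemma const_ideal_uminus: "a \<in> const_ideal \<Longrightarrow> - a \<in> const_ideal"
  using const_ideal_closed(3)[of a "-1"] by simp

text \<open>\<open>'n qalg\<close> is the real free product of the quaternions and the free real algebra on the
  letters \<open>q\<^sub>i\<close>, \<open>q\<^sub>i\<^sup>*\<close>: the free real algebra on the disjoint union of the set of quaternions and
  the set of letters, modulo the relations making the inclusion of the quaternions a homomorphism
  of unital real algebras. The universal property is \<open>qalg_lift_unique\<close> and the lemmas preceding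
  it.\<close>

quotient_type 'n qalg = "'n gen list \<Rightarrow>\<^sub>0 real" / "\<lambda>p q. p - q \<in> const_ideal"
proof (rule equivpI)
  show "reflp (\<lambda>p q :: 'n gen list \<Rightarrow>\<^sub>0 real. p - q \<in> const_ideal)"
    by (rule reflpI) (simp add: const_ideal_closed(1))
  show "symp (\<lambda>p q :: 'n gen list \<Rightarrow>\<^sub>0 real. p - q \<in> const_ideal)"
    by (rule sympI) (metis const_ideal_uminus minus_diff_eq)
  show "transp (\<lambda>p q :: 'n gen list \<Rightarrow>\<^sub>0 real. p - q \<in> const_ideal)"
    by (rule transpI) (drule (1) const_ideal_closed(2), simp)
qed

instantiation qalg :: (type) real_algebra_1
begin

lift_definition zero_qalg :: "'a qalg" is 0 .
lift_definition one_qalg :: "'a qalg" is 1 .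
lift_definition plus_qalg :: "'a qalg \<Rightarrow> 'a qalg \<Rightarrow> 'a qalg" is "(+)"
  by (metis const_ideal_closed(2) add_diff_add)
lift_definition uminus_qalg :: "'a qalg \<Rightarrow> 'a qalg" is uminus
  by (metis const_ideal_uminus minus_diff_minus)
lift_definition minus_qalg :: "'a qalg \<Rightarrow> 'a qalg \<Rightarrow> 'a qalg" is "(-)"
proof -
  fix p p' q q' :: "'a gen list \<Rightarrow>\<^sub>0 real"
  assume "p - p' \<in> const_ideal" "q - q' \<in> const_ideal"
  then have "(p - p') + - (q - q') \<in> const_ideal"
    by (rule const_ideal_closed(2)[OF _ const_ideal_uminus])
  then show "(p - q) - (p' - q') \<in> const_ideal"
    by (simp add: algebra_simps)
qed
lift_definition times_qalg :: "'a qalg \<Rightarrow> 'a qalg \<Rightarrow> 'a qalg" is "(*)"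
proof -
  fix p p' q q' :: "'a gen list \<Rightarrow>\<^sub>0 real"
  assume "p - p' \<in> const_ideal" "q - q' \<in> const_ideal"
  then have "(p - p') * q + p' * (q - q') \<in> const_ideal"
    by (rule const_ideal_closed(2)[OF const_ideal_closed(4) const_ideal_closed(3)])
  then show "p * q - p' * q' \<in> const_ideal"
    by (simp add: algebra_simps)
qed
lift_definition scaleR_qalg :: "real \<Rightarrow> 'a qalg \<Rightarrow> 'a qalg" is scaleR
proof -
  fix r :: real and p q :: "'a gen list \<Rightarrow>\<^sub>0 real"
  assume "p - q \<in> const_ideal"
  then have "(r *\<^sub>R 1) * (p - q) \<in> const_ideal"
    by (rule const_ideal_closed(3))
  then show "r *\<^sub>R p - r *\<^sub>R q \<in> const_ideal"
    by (simp add: scaleR_diff_right)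
qed

lemma const_notin_ideal: "(1 :: 'a gen list \<Rightarrow>\<^sub>0 real) \<notin> const_ideal"
proof
  define g :: "'a gen \<Rightarrow> quat" where "g = case_gen (\<lambda>a. a) (\<lambda>_. 0) (\<lambda>_. 0)"
  have "const_ideal \<subseteq> {p. eval_words g p = 0}"
  proof (rule const_ideal_subset)
    show "ideal {p. eval_words g p = 0} ring_of_type_algebra"
      by (auto simp: ideal_ring_of_type_algebra_iff eval_words_add eval_words_mult)
    show "const_rels \<subseteq> {p. eval_words g p = 0}"
      by (auto elim!: const_rels.cases
          simp: eval_words_minus eval_words_add eval_words_mult scaleR_single g_def)
  qed
  moreover assume "(1 :: 'a gen list \<Rightarrow>\<^sub>0 real) \<in> const_ideal"
  ultimately show False by auto
qed

instance
proof
  show "(0 :: 'a qalg) \<noteq> 1"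
    by transfer (use const_notin_ideal const_ideal_uminus in fastforce)
qed (transfer, rule const_ideal_eqI, simp add: algebra_simps)+

end

lift_definition qconst :: "quat \<Rightarrow> 'n qalg" is "\<lambda>a. Poly_Mapping.single [Cst a] 1" .
lift_definition ltr :: "'n \<Rightarrow> 'n qalg" is "\<lambda>i. Poly_Mapping.single [Ltr i] 1" .
lift_definition ltrs :: "'n \<Rightarrow> 'n qalg" is "\<lambda>i. Poly_Mapping.single [LtrS i] 1" .

lemma qconst_hom [simp]:
  "qconst (a + b) = (qconst a + qconst b :: 'n qalg)"
  "qconst (a * b) = (qconst a * qconst b :: 'n qalg)"
  "qconst (r *\<^sub>R a) = (r *\<^sub>R qconst a :: 'n qalg)"
  "qconst 1 = (1 :: 'n qalg)"
  by (transfer, rule subsetD[OF const_rels_subset], rule const_rels.intros)+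

lemma qalg_induct [case_names const ltr ltrs add mult]:
  assumes const: "\<And>a. P (qconst a)" and ltr: "\<And>i. P (ltr i)" and ltrs: "\<And>i. P (ltrs i)"
    and add: "\<And>x y. P x \<Longrightarrow> P y \<Longrightarrow> P (x + y)" and mult: "\<And>x y. P x \<Longrightarrow> P y \<Longrightarrow> P (x * y)"
  shows "P (x :: 'n qalg)"
proof (induction x rule: qalg.abs_induct)
  fix p :: "'n gen list \<Rightarrow>\<^sub>0 real"
  show "P (abs_qalg p)"
  proof (induction p rule: poly_mapping_additive_induct)
    case (add p q)
    then show ?case using assms(4) by (metis plus_qalg.abs_eq)
  next
    case (single w c)
    have word: "P (abs_qalg (Poly_Mapping.single w 1))"
    proof (induction w)
      case Nil
      have "abs_qalg (Poly_Mapping.single [] 1) = (qconst 1 :: 'n qalg)"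
        by (simp add: one_qalg_def zero_list_def flip: single_one)
      then show ?case using const by metis
    next
      case (Cons g w)
      have "abs_qalg (Poly_Mapping.single (g # w) 1) =
        abs_qalg (Poly_Mapping.single [g] 1) * abs_qalg (Poly_Mapping.single w 1)"
        by (simp add: times_qalg.abs_eq mult_single plus_list_def)
      moreover have "P (abs_qalg (Poly_Mapping.single [g] 1))"
        using const ltr ltrs
        by (cases g) (simp_all add: qconst.abs_eq ltr.abs_eq ltrs.abs_eq)
      ultimately show ?case using mult Cons by simp
    qed
    have "abs_qalg (Poly_Mapping.single w c) = qconst (c *\<^sub>R 1) * abs_qalg (Poly_Mapping.single w 1)"
      by (simp add: scaleR_qalg.abs_eq scaleR_single)
    then show ?case using mult[OF const word, of "c *\<^sub>R 1"] by (simp only:)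
  qed
qed


subsection \<open>Universal property\<close>

definition qalg_lift ::
  "(quat \<Rightarrow> 'c::real_algebra_1) \<Rightarrow> ('n \<Rightarrow> 'c) \<Rightarrow> ('n \<Rightarrow> 'c) \<Rightarrow> 'n qalg \<Rightarrow> 'c" where
  "qalg_lift h u v x = eval_words (case_gen h u v) (rep_qalg x)"

definition real_alg_hom :: "('a::real_algebra_1 \<Rightarrow> 'b::real_algebra_1) \<Rightarrow> bool" where
  "real_alg_hom h \<longleftrightarrow> (\<forall>a b. h (a + b) = h a + h b) \<and> (\<forall>a b. h (a * b) = h a * h b) \<and>
     (\<forall>r a. h (r *\<^sub>R a) = r *\<^sub>R h a) \<and> h 1 = 1"

lemma qalg_lift_abs:
  assumes "real_alg_hom h"
  shows "qalg_lift h u v (abs_qalg p) = eval_words (case_gen h u v) p"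
proof -
  let ?g = "case_gen h u v"
  have "const_ideal \<subseteq> {p. eval_words ?g p = 0}"
  proof (rule const_ideal_subset)
    show "ideal {p. eval_words ?g p = 0} ring_of_type_algebra"
      by (auto simp: ideal_ring_of_type_algebra_iff eval_words_add eval_words_mult)
    show "const_rels \<subseteq> {p. eval_words ?g p = 0}"
      using assms by (auto elim!: const_rels.cases
          simp: eval_words_minus eval_words_add eval_words_mult scaleR_single real_alg_hom_def)
  qed
  moreover have "rep_qalg (abs_qalg p) - p \<in> const_ideal"
    using Quotient3_rep_abs[OF Quotient3_qalg, of p] by (simp add: const_ideal_closed(1))
  ultimately show ?thesis
    by (auto simp: qalg_lift_def eval_words_minus)
qed

lemma qalg_lift_hom:
  assumes "real_alg_hom h"
  shows "real_alg_hom (qalg_lift h u v)"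
  unfolding real_alg_hom_def
proof (intro conjI allI)
  fix x y :: "'b qalg" and r
  show "qalg_lift h u v (x + y) = qalg_lift h u v x + qalg_lift h u v y"
    by (induction x rule: qalg.abs_induct, induction y rule: qalg.abs_induct)
      (simp add: plus_qalg.abs_eq qalg_lift_abs[OF assms] eval_words_add)
  show *: "qalg_lift h u v (x * y) = qalg_lift h u v x * qalg_lift h u v y" for x y :: "'b qalg"
    by (induction x rule: qalg.abs_induct, induction y rule: qalg.abs_induct)
      (simp add: times_qalg.abs_eq qalg_lift_abs[OF assms] eval_words_mult)
  show 1: "qalg_lift h u v (1 :: 'b qalg) = 1"
    by (simp add: one_qalg_def qalg_lift_abs[OF assms])
  have "qalg_lift h u v (r *\<^sub>R 1 :: 'b qalg) = r *\<^sub>R 1"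
    by (simp add: one_qalg_def scaleR_qalg.abs_eq qalg_lift_abs[OF assms] scaleR_single
        zero_list_def flip: single_one)
  then show "qalg_lift h u v (r *\<^sub>R x) = r *\<^sub>R qalg_lift h u v x"
    using *[of "r *\<^sub>R 1" x] by simp
qed

lemma qalg_lift_simps:
  assumes "real_alg_hom h"
  shows "qalg_lift h u v (qconst a) = h a" "qalg_lift h u v (ltr i) = u i"
    "qalg_lift h u v (ltrs i) = v i"
  by (simp_all add: qconst.abs_eq ltr.abs_eq ltrs.abs_eq qalg_lift_abs[OF assms])

lemma qalg_lift_unique:
  assumes "real_alg_hom h" "real_alg_hom f"
    and "\<And>a. f (qconst a) = h a" "\<And>i. f (ltr i) = u i" "\<And>i. f (ltrs i) = v i"
  shows "f = qalg_lift h u v"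
proof
  fix x
  show "f x = qalg_lift h u v x"
    using assms(2) qalg_lift_hom[OF assms(1), of u v]
    by (induction x rule: qalg_induct)
      (simp_all add: assms(3-5) qalg_lift_simps[OF assms(1)] real_alg_hom_def)
qed


subsection \<open>Involution\<close>

fun gen_star :: "'n gen \<Rightarrow> 'n gen" where
  "gen_star (Cst a) = Cst (qcnj a)"
| "gen_star (Ltr i) = LtrS i"
| "gen_star (LtrS i) = Ltr i"

definition word_star :: "'n gen list \<Rightarrow> 'n gen list" where
  "word_star w = rev (map gen_star w)"

lemma gen_star_gen_star [simp]: "gen_star (gen_star g) = g"
  by (cases g) auto

lemma word_star_word_star [simp]: "word_star (word_star w) = w"
  by (induction w) (simp_all add: word_star_def rev_map)

lemma inj_word_star: "inj word_star"
  by (metis injI word_star_word_star)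

text \<open>As \<^const>\<open>word_star\<close> is its own inverse, \<open>map_key word_star\<close> is the linear extension of
  \<^const>\<open>word_star\<close>.\<close>

definition free_star :: "('n gen list \<Rightarrow>\<^sub>0 real) \<Rightarrow> ('n gen list \<Rightarrow>\<^sub>0 real)" where
  "free_star = Poly_Mapping.map_key word_star"

lemma free_star_single [simp]:
  "free_star (Poly_Mapping.single w c) = Poly_Mapping.single (word_star w) c"
  unfolding free_star_def by (metis inj_word_star map_key_single word_star_word_star)

lemma free_star_add: "free_star (p + q) = free_star p + free_star q"
  unfolding free_star_def by (rule map_key_plus[OF inj_word_star])

lemma free_star_0 [simp]: "free_star 0 = 0"
  unfolding free_star_def by (rule map_key_zero[OF inj_word_star])

lemma free_star_1 [simp]: "free_star 1 = 1"
  unfolding single_one[symmetric] by (simp add: word_star_def zero_list_def)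

lemma free_star_minus: "free_star (p - q) = free_star p - free_star q"
  by (metis add_diff_cancel_right' diff_add_cancel free_star_add)

lemma free_star_scaleR: "free_star (r *\<^sub>R p) = r *\<^sub>R free_star p"
  by (induction p rule: poly_mapping_additive_induct)
    (simp_all add: scaleR_single free_star_add scaleR_add_right)

lemma free_star_free_star: "free_star (free_star p) = p"
  by (induction p rule: poly_mapping_additive_induct) (simp_all add: free_star_add)

lemma free_star_mult: "free_star (p * q) = free_star q * free_star p"
proof (induction p rule: poly_mapping_additive_induct)
  case (single v a)
  show ?case
    by (induction q rule: poly_mapping_additive_induct)
      (simp_all add: mult_single plus_list_def distrib_left distrib_right free_star_add
        word_star_def mult.commute)
qed (simp add: distrib_left distrib_right free_star_add)

lift_definition star :: "'n qalg \<Rightarrow> 'n qalg" is free_star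
proof -
  fix p q :: "'n gen list \<Rightarrow>\<^sub>0 real"
  have "const_ideal \<subseteq> {p :: 'n gen list \<Rightarrow>\<^sub>0 real. free_star p \<in> const_ideal}"
  proof (rule const_ideal_subset)
    show "ideal {p :: 'n gen list \<Rightarrow>\<^sub>0 real. free_star p \<in> const_ideal} ring_of_type_algebra"
      by (auto simp: ideal_ring_of_type_algebra_iff free_star_add free_star_mult
          intro: const_ideal_closed)
    have "free_star p \<in> const_rels" if "p \<in> const_rels" for p :: "'n gen list \<Rightarrow>\<^sub>0 real"
      using that
      by cases (simp_all add: free_star_minus free_star_add free_star_mult free_star_scaleR
          word_star_def const_rels.intros)
    then show "const_rels \<subseteq> {p :: 'n gen list \<Rightarrow>\<^sub>0 real. free_star p \<in> const_ideal}"
      using const_rels_subset by blast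
  qed
  moreover assume "p - q \<in> const_ideal"
  ultimately show "free_star p - free_star q \<in> const_ideal"
    by (auto simp: free_star_minus)
qed

lemma star_simps [simp]:
  "star (x + y) = star x + star y" "star (x * y) = star y * star x"
  "star (star x) = x" "star 1 = 1"
  "star (qconst a) = qconst (qcnj a)" "star (ltr i) = ltrs i" "star (ltrs i) = ltr i"
  by (transfer, rule const_ideal_eqI,
      simp add: free_star_add free_star_mult free_star_free_star word_star_def)+


section \<open>The polynomial ring and the evaluation homomorphism\<close>

text \<open>A monomial is an exponent vector; the variables are central because exponents and
  coefficients are multiplied separately.\<close>

type_synonym 'n qpoly = "('n \<times> comp \<Rightarrow>\<^sub>0 nat) \<Rightarrow>\<^sub>0 quat"

definition pconst :: "quat \<Rightarrow> 'n qpoly" where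
  "pconst a = Poly_Mapping.single 0 a"

definition pvar :: "'n \<Rightarrow> comp \<Rightarrow> 'n qpoly" where
  "pvar i j = Poly_Mapping.single (Poly_Mapping.single (i, j) 1) 1"

definition pstar :: "'n qpoly \<Rightarrow> 'n qpoly" where
  "pstar = Poly_Mapping.map qcnj"

definition rho :: "'n qalg \<Rightarrow> 'n qpoly" where
  "rho = qalg_lift pconst
     (\<lambda>i. pvar i c1 + pvar i c2 * pconst qI + pvar i c3 * pconst qJ + pvar i c4 * pconst qK)
     (\<lambda>i. pvar i c1 - pvar i c2 * pconst qI - pvar i c3 * pconst qJ - pvar i c4 * pconst qK)"

lemma real_alg_hom_pconst: "real_alg_hom pconst"
  by (simp add: real_alg_hom_def pconst_def single_add mult_single scaleR_single single_one)

lemma pstar_single [simp]: "pstar (Poly_Mapping.single k a) = Poly_Mapping.single k (qcnj a)"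
  by (simp add: pstar_def)

lemma pstar_add: "pstar (p + q) = pstar p + pstar q"
  by (rule poly_mapping_eqI) (simp add: pstar_def map.rep_eq lookup_add when_def, metis qcnj_simps(1,6) add_0)

lemma pstar_minus: "pstar (p - q) = pstar p - pstar q"
  by (metis add_diff_cancel_right' diff_add_cancel pstar_add)

lemma pstar_mult: "pstar (p * q) = pstar q * pstar p"
proof (induction p rule: poly_mapping_additive_induct)
  case (single v a)
  show ?case
    by (induction q rule: poly_mapping_additive_induct)
      (simp_all add: mult_single distrib_left distrib_right pstar_add add.commute)
qed (simp add: distrib_left distrib_right pstar_add)

lemma rho_hom: "real_alg_hom rho"
  unfolding rho_def by (rule qalg_lift_hom[OF real_alg_hom_pconst])

lemma rho_simps:
  "rho (x + y) = rho x + rho y" "rho (x * y) = rho x * rho y" "rho (r *\<^sub>R x) = r *\<^sub>R rho x"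
  "rho 1 = 1" "rho (qconst a) = pconst a"
  "rho (ltr i) = pvar i c1 + pvar i c2 * pconst qI + pvar i c3 * pconst qJ + pvar i c4 * pconst qK"
  "rho (ltrs i) = pvar i c1 - pvar i c2 * pconst qI - pvar i c3 * pconst qJ - pvar i c4 * pconst qK"
  using rho_hom qalg_lift_simps[OF real_alg_hom_pconst]
  by (auto simp: real_alg_hom_def rho_def)

lemma rho_star: "rho (star x) = pstar (rho x)"
  by (induction x rule: qalg_induct)
    (simp_all add: rho_simps pstar_add pstar_minus pstar_mult pconst_def pvar_def mult_single single_uminus)


section \<open>The scalar-identity ideal and its generators\<close>

definition scalar_identity_ideal :: "'n qalg set" where
  "scalar_identity_ideal = a_kernel ring_of_type_algebra ring_of_type_algebra rho"

definition star_ideal_gen :: "'n qalg set \<Rightarrow> 'n qalg set" where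
  "star_ideal_gen S = \<Inter>{I. ideal I ring_of_type_algebra \<and> star ` I \<subseteq> I \<and> S \<subseteq> I}"

definition commutator :: "'a::ring \<Rightarrow> 'a \<Rightarrow> 'a" where
  "commutator a b = a * b - b * a"

fun chi :: "'n \<Rightarrow> comp \<Rightarrow> 'n qalg" where
  "chi i c1 = (1/2) *\<^sub>R (ltr i + ltrs i)"
| "chi i c2 = (1/2) *\<^sub>R (qconst qI * ltrs i - ltr i * qconst qI)"
| "chi i c3 = (1/2) *\<^sub>R (qconst qJ * ltrs i - ltr i * qconst qJ)"
| "chi i c4 = (1/2) *\<^sub>R (qconst qK * ltrs i - ltr i * qconst qK)"

definition gen_C :: "'n \<Rightarrow> comp \<Rightarrow> quat \<Rightarrow> 'n qalg" where
  "gen_C i j u = commutator (chi i j) (qconst u)"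

definition gen_D :: "'n \<Rightarrow> comp \<Rightarrow> 'n \<Rightarrow> comp \<Rightarrow> 'n qalg" where
  "gen_D i j k l = commutator (chi i j) (chi k l)"

definition gen_R :: "'n \<Rightarrow> 'n qalg" where
  "gen_R i = ltr i - chi i c1 - chi i c2 * qconst qI - chi i c3 * qconst qJ - chi i c4 * qconst qK"

end

theory Submission
  imports Defs
begin

text \<open>The kernel contains the generators because \<^const>\<open>rho\<close> maps \<^term>\<open>chi i j\<close> to the variable
  \<^term>\<open>pvar i j\<close>. Conversely, sending the variable \<^term>\<open>pvar i j\<close> back to \<^term>\<open>chi i j\<close> defines
  an additive section \<open>\<sigma>\<close> of \<^const>\<open>rho\<close>, once an order of the factors is chosen in every monomial.
  Modulo an ideal containing the generators, the \<^term>\<open>chi i j\<close> commute with the constants and with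
  each other, so the elements congruent to a value of \<open>\<sigma>\<close> form a subalgebra; it contains the letters
  by the relations \<^const>\<open>gen_R\<close>. Hence every \<open>x\<close> is congruent to some \<open>\<sigma> p\<close>, and if \<open>x\<close> is in the
  kernel then \<open>p = rho (\<sigma> p) = 0\<close>.\<close>

section \<open>Images of the generators\<close>

lemma rho_zero [simp]: "rho 0 = 0"
  using rho_simps(1)[of 0 0] by simp

lemma rho_diff: "rho (x - y) = rho x - rho y"
  using rho_simps(1)[of "x - y" y] by (simp add: algebra_simps)

lemma pconst_pvar_commute: "pconst a * pvar i j = pvar i j * pconst a"
  by (simp add: pconst_def pvar_def mult_single)

lemma pvar_pvar_commute: "pvar i j * pvar k l = pvar k l * pvar i j"
  by (simp add: pvar_def mult_single add.commute)

text \<open>For a unit u, the conjugate of u times q-bar is minus q times u. So the image of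
  \<open>chi\<close> is the real part of q or of u times q-bar, and this is one real coordinate of
  q.\<close>

lemma rho_chi: "rho (chi i j) = pvar i j"
  by (cases j; rule poly_mapping_eqI)
    (simp_all add: rho_simps rho_diff algebra_simps pconst_def pvar_def mult_single
      lookup_add lookup_minus lookup_scaleR lookup_single when_def quat_units quat_ops
      qI_def qJ_def qK_def)

lemma rho_gen_C: "rho (gen_C i j u) = 0"
  by (simp add: gen_C_def commutator_def rho_diff rho_simps rho_chi pconst_pvar_commute)

lemma rho_gen_D: "rho (gen_D i j k l) = 0"
  by (simp add: gen_D_def commutator_def rho_diff rho_simps rho_chi pvar_pvar_commute)

lemma rho_gen_R: "rho (gen_R i) = 0"
  by (simp add: gen_R_def rho_diff rho_simps rho_chi del: chi.simps)

lemma scalar_identity_ideal_iff: "x \<in> scalar_identity_ideal \<longleftrightarrow> rho x = 0"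
  by (simp add: scalar_identity_ideal_def a_kernel_def')

lemma ideal_scalar_identity_ideal: "ideal scalar_identity_ideal ring_of_type_algebra"
  by (simp add: ideal_ring_of_type_algebra_iff scalar_identity_ideal_iff rho_simps)

lemma star_scalar_identity_ideal: "star ` scalar_identity_ideal \<subseteq> scalar_identity_ideal"
  \<comment> \<open>This instance yields \<open>pstar 0 = 0\<close>.\<close>
  using pstar_minus[of 0 0] by (auto simp: scalar_identity_ideal_iff rho_star)

lemma ring_hom_ring_rho: "ring_hom_ring ring_of_type_algebra ring_of_type_algebra rho"
  by (rule ring_hom_ringI) (simp_all add: ring_ring_of_type_algebra rho_simps)


section \<open>A section of the evaluation homomorphism\<close>

definition word_monomial :: "'v list \<Rightarrow> ('v \<Rightarrow>\<^sub>0 nat)" where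
  "word_monomial w = sum_list (map (\<lambda>v. Poly_Mapping.single v 1) w)"

lemma lookup_word_monomial: "Poly_Mapping.lookup (word_monomial w) v = count (mset w) v"
  by (induction w) (auto simp: word_monomial_def lookup_add lookup_single when_def)

text \<open>Exponents are multiplicities of letters, so the fibres of abelianization are the
  permutation classes of words.\<close>

lemma word_monomial_eq_iff: "word_monomial u = word_monomial w \<longleftrightarrow> mset u = mset w"
  by (auto simp: poly_mapping_eq_iff multiset_eq_iff fun_eq_iff lookup_word_monomial)

lemma word_monomial_append: "word_monomial (u @ w) = word_monomial u + word_monomial w"
  by (simp add: word_monomial_def)

lemma word_monomial_replicate: "word_monomial (replicate n v) = Poly_Mapping.single v n"
  by (rule poly_mapping_eqI) (simp add: lookup_word_monomial lookup_single when_def)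

lemma ex_word_monomial: "\<exists>w. word_monomial w = m"
proof (induction m rule: poly_mapping_additive_induct)
  case (single v n)
  show ?case by (rule exI, rule word_monomial_replicate)
next
  case (add m m')
  then show ?case using word_monomial_append by metis
qed

text \<open>This choice fixes the order of the factors in each monomial. It need not turn sums of
  exponents into concatenations, so \<open>rho_section\<close> is shown to be multiplicative only
  modulo the relations.\<close>

definition monomial_word :: "('v \<Rightarrow>\<^sub>0 nat) \<Rightarrow> 'v list" where
  "monomial_word m = (SOME w. word_monomial w = m)"

lemma word_monomial_monomial_word [simp]: "word_monomial (monomial_word m) = m"
  unfolding monomial_word_def by (rule someI_ex[OF ex_word_monomial])

text \<open>No other word has an empty multiset of letters, so the choice is forced here. Hence
  \<open>rho_section\<close> sends \<open>pconst a\<close> to \<open>qconst a\<close>.\<close>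

lemma monomial_word_0 [simp]: "monomial_word 0 = []"
proof -
  have "word_monomial (monomial_word 0) = word_monomial []"
    unfolding word_monomial_monomial_word by (simp add: word_monomial_def)
  then show ?thesis by (simp only: word_monomial_eq_iff) simp
qed

definition chi_word :: "('n \<times> comp) list \<Rightarrow> 'n qalg" where
  "chi_word w = prod_list (map (case_prod chi) w)"

lemma chi_word_simps [simp]:
  "chi_word [] = 1" "chi_word (v # w) = case_prod chi v * chi_word w"
  "chi_word (u @ w) = chi_word u * chi_word w"
  by (simp_all add: chi_word_def)

definition rho_section :: "'n qpoly \<Rightarrow> 'n qalg" where
  "rho_section p = (\<Sum>m\<in>Poly_Mapping.keys p.
     qconst (Poly_Mapping.lookup p m) * chi_word (monomial_word m))"

lemma qconst_0 [simp]: "qconst 0 = 0"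
  using qconst_hom(3)[of 0 0] by simp

lemma rho_section_superset:
  assumes "finite S" "Poly_Mapping.keys p \<subseteq> S"
  shows "rho_section p = (\<Sum>m\<in>S. qconst (Poly_Mapping.lookup p m) * chi_word (monomial_word m))"
  unfolding rho_section_def using assms
  by (intro sum.mono_neutral_left) (auto simp: in_keys_iff)

lemma rho_section_single:
  "rho_section (Poly_Mapping.single m a) = qconst a * chi_word (monomial_word m)"
  by (subst rho_section_superset[of "{m}"]) auto

lemma rho_section_0 [simp]: "rho_section 0 = 0"
  by (simp add: rho_section_def)

lemma rho_section_add: "rho_section (p + q) = rho_section p + rho_section q"
proof -
  let ?S = "Poly_Mapping.keys p \<union> Poly_Mapping.keys q"
  have "Poly_Mapping.keys (p + q) \<subseteq> ?S" by (rule keys_add)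
  then show ?thesis
    using rho_section_superset[of ?S "p + q"] rho_section_superset[of ?S p]
      rho_section_superset[of ?S q]
    by (simp add: lookup_add distrib_right sum.distrib)
qed

lemma rho_chi_word: "rho (chi_word w) = Poly_Mapping.single (word_monomial w) 1"
  by (induction w)
    (auto simp: rho_simps rho_chi pvar_def mult_single word_monomial_def single_one)

text \<open>The word chosen for a monomial abelianizes back to it, in whatever order its letters
  stand.\<close>

lemma rho_rho_section: "rho (rho_section p) = p"
  by (induction p rule: poly_mapping_additive_induct)
    (simp_all add: rho_section_single rho_section_add rho_simps rho_chi_word pconst_def mult_single)


section \<open>Reduction modulo the generators\<close>

text \<open>The ideal is left arbitrary so that it can be the intersection of a competing ideal with
  the kernel.\<close>

locale generated_ideal =
  fixes I :: "'n qalg set"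
  assumes ideal: "ideal I ring_of_type_algebra"
    and gen_C_mem: "u \<in> {qI, qJ, qK} \<Longrightarrow> gen_C i j u \<in> I"
    and gen_D_mem: "gen_D i j k l \<in> I"
    and gen_R_mem: "gen_R i \<in> I"
begin

definition eqv :: "'n qalg \<Rightarrow> 'n qalg \<Rightarrow> bool"  (infix \<open>\<approx>\<close> 50) where
  "x \<approx> y \<longleftrightarrow> x - y \<in> I"

lemma mem_closed:
  "0 \<in> I" "a \<in> I \<Longrightarrow> b \<in> I \<Longrightarrow> a + b \<in> I" "a \<in> I \<Longrightarrow> x * a \<in> I" "a \<in> I \<Longrightarrow> a * x \<in> I"
  using ideal[unfolded ideal_ring_of_type_algebra_iff] by blast+

lemma eqv_refl [simp]: "x \<approx> x"
  by (simp add: eqv_def mem_closed)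

lemma eqv_sym: "x \<approx> y \<Longrightarrow> y \<approx> x"
  using mem_closed(3)[of "x - y" "- 1"] by (simp add: eqv_def)

lemma eqv_trans [trans]: "x \<approx> y \<Longrightarrow> y \<approx> z \<Longrightarrow> x \<approx> z"
  using mem_closed(2)[of "x - y" "y - z"] by (simp add: eqv_def)

lemma eqv_add: "x \<approx> x' \<Longrightarrow> y \<approx> y' \<Longrightarrow> x + y \<approx> x' + y'"
  using mem_closed(2)[of "x - x'" "y - y'"] by (simp add: eqv_def algebra_simps)

lemma eqv_mult: "x \<approx> x' \<Longrightarrow> y \<approx> y' \<Longrightarrow> x * y \<approx> x' * y'"
  using mem_closed(2)[OF mem_closed(4)[of "x - x'" y] mem_closed(3)[of "y - y'" x']]
  by (simp add: eqv_def algebra_simps)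

lemma eqv_scaleR: "x \<approx> y \<Longrightarrow> r *\<^sub>R x \<approx> r *\<^sub>R y"
  using eqv_mult[OF eqv_refl, of x y "r *\<^sub>R 1"] by simp

section \<open>Commutation modulo the ideal\<close>

lemma eqv_commute_mult:
  assumes "x * z \<approx> z * x" "y * z \<approx> z * y"
  shows "(x * y) * z \<approx> z * (x * y)"
proof -
  have "x * y * z \<approx> x * z * y"
    using eqv_mult[OF eqv_refl assms(2), of x] by (simp add: mult.assoc)
  also have "x * z * y \<approx> z * (x * y)"
    using eqv_mult[OF assms(1) eqv_refl, of y] by (simp add: mult.assoc)
  finally show ?thesis .
qed

text \<open>The relations treat only i, j and k; real linearity does the rest, since these and 1
  span the quaternions.\<close>

lemma chi_qconst_commute: "chi i j * qconst a \<approx> qconst a * chi i j"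
proof -
  have unit: "chi i j * qconst u \<approx> qconst u * chi i j" if "u \<in> {qI, qJ, qK}" for u
    using gen_C_mem[OF that, of i j] by (simp add: eqv_def gen_C_def commutator_def)
  have "qconst a = qre a *\<^sub>R 1 + qi a *\<^sub>R qconst qI + qj a *\<^sub>R qconst qJ
      + qk a *\<^sub>R (qconst qK :: 'n qalg)"
    by (subst quat_expand) (simp only: qconst_hom)
  then show ?thesis
    by (simp add: distrib_left distrib_right eqv_add eqv_scaleR unit del: chi.simps)
qed

lemma chi_chi_commute: "chi i j * chi k l \<approx> chi k l * chi i j"
  using gen_D_mem[of i j k l] by (simp add: eqv_def gen_D_def commutator_def)

lemma chi_word_commute:
  assumes "\<And>i j. chi i j * z \<approx> z * chi i j"
  shows "chi_word w * z \<approx> z * chi_word w"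
  by (induction w) (auto intro: eqv_commute_mult assms simp del: chi.simps)

text \<open>The first letter of \<open>u\<close> occurs somewhere in \<open>w\<close>. Delete it
  there, apply the induction hypothesis to what remains, and move the letter back past the prefix
  \<open>w1\<close>.\<close>

lemma chi_word_perm: "mset u = mset w \<Longrightarrow> chi_word u \<approx> chi_word w"
proof (induction u arbitrary: w)
  case (Cons v u)
  then have "v \<in> set w" by (metis list.set_intros(1) mset_eq_setD)
  then obtain w1 w2 where w: "w = w1 @ v # w2" by (meson split_list)
  let ?c = "case_prod chi v"
  have "chi_word (v # u) \<approx> ?c * chi_word (w1 @ w2)"
    using Cons.IH[of "w1 @ w2"] Cons.prems w by (simp add: eqv_mult)
  also have "\<dots> = (?c * chi_word w1) * chi_word w2"
    by (simp add: mult.assoc)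
  also have "\<dots> \<approx> (chi_word w1 * ?c) * chi_word w2"
  proof (intro eqv_mult[OF _ eqv_refl] eqv_sym[OF chi_word_commute])
    show "chi i j * ?c \<approx> ?c * chi i j" for i j
      by (cases v) (simp add: chi_chi_commute del: chi.simps)
  qed
  finally show ?case
    by (simp add: w mult.assoc)
qed simp

text \<open>By additivity single terms suffice. There \<open>b\<close> moves left past the first
  word, and the two words joined are a permutation of the word chosen for the product
  monomial.\<close>

lemma rho_section_mult: "rho_section (p * q) \<approx> rho_section p * rho_section q"
proof (induction p rule: poly_mapping_additive_induct)
  case (single m a)
  show ?case
  proof (induction q rule: poly_mapping_additive_induct)
    case (single m' b)
    let ?u = "chi_word (monomial_word m)" and ?v = "chi_word (monomial_word m')"
    have "chi_word (monomial_word (m + m')) \<approx> ?u * ?v"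
      unfolding chi_word_simps(3)[symmetric]
      by (rule chi_word_perm) (simp add: word_monomial_append del: mset_append flip: word_monomial_eq_iff)
    then have "qconst (a * b) * chi_word (monomial_word (m + m')) \<approx>
        qconst a * (qconst b * ?u) * ?v"
      using eqv_mult[OF eqv_refl, of _ _ "qconst (a * b)"] by (simp add: mult.assoc)
    also have "\<dots> \<approx> qconst a * (?u * qconst b) * ?v"
      by (intro eqv_mult eqv_refl eqv_sym[OF chi_word_commute] chi_qconst_commute)
    finally show ?case
      by (simp add: mult_single rho_section_single mult.assoc)
  qed (simp add: distrib_left rho_section_add eqv_add)
qed (simp add: distrib_right rho_section_add eqv_add)

section \<open>The subalgebra of reducible elements\<close>

definition reducible :: "'n qalg set" where
  "reducible = {x. \<exists>p. x \<approx> rho_section p}"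

lemma reducibleI: "x \<approx> rho_section p \<Longrightarrow> x \<in> reducible"
  by (auto simp: reducible_def)

lemma reducibleE:
  assumes "x \<in> reducible"
  obtains p where "x \<approx> rho_section p"
  using assms by (auto simp: reducible_def)

lemma reducible_eqv: "x \<approx> y \<Longrightarrow> y \<in> reducible \<Longrightarrow> x \<in> reducible"
  by (elim reducibleE) (rule reducibleI, rule eqv_trans)

lemma reducible_add:
  assumes "x \<in> reducible" "y \<in> reducible"
  shows "x + y \<in> reducible"
proof -
  obtain p q where "x \<approx> rho_section p" "y \<approx> rho_section q"
    using assms by (elim reducibleE)
  then have "x + y \<approx> rho_section (p + q)"
    by (simp add: rho_section_add eqv_add)
  then show ?thesis by (rule reducibleI)
qed

lemma reducible_mult:
  assumes "x \<in> reducible" "y \<in> reducible"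
  shows "x * y \<in> reducible"
proof -
  obtain p q where "x \<approx> rho_section p" "y \<approx> rho_section q"
    using assms by (elim reducibleE)
  then have "x * y \<approx> rho_section p * rho_section q"
    by (rule eqv_mult)
  also have "\<dots> \<approx> rho_section (p * q)"
    by (rule eqv_sym[OF rho_section_mult])
  finally show ?thesis by (rule reducibleI)
qed

lemma reducible_qconst: "qconst a \<in> reducible"
proof -
  have "qconst a \<approx> rho_section (pconst a)"
    by (simp add: pconst_def rho_section_single)
  then show ?thesis by (rule reducibleI)
qed

lemma reducible_scaleR: "x \<in> reducible \<Longrightarrow> r *\<^sub>R x \<in> reducible"
  using reducible_mult[OF reducible_qconst[of "r *\<^sub>R 1"], of x] by simp

lemma reducible_chi: "chi i j \<in> reducible"
proof -
  \<comment> \<open>The word chosen for a single variable is compared with the one-letter word by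
    permutation, without computing the choice.\<close>
  have "chi_word [(i, j)] \<approx> chi_word (monomial_word (Poly_Mapping.single (i, j) 1))"
    using word_monomial_replicate[of 1 "(i, j)"]
    by (intro chi_word_perm, unfold word_monomial_eq_iff[symmetric]) simp
  then have "chi i j \<approx> rho_section (pvar i j)"
    by (simp add: pvar_def rho_section_single del: chi.simps)
  then show ?thesis by (rule reducibleI)
qed

lemma reducible_ltr: "ltr i \<in> reducible"
proof (rule reducible_eqv)
  show "ltr i \<approx> chi i c1 + chi i c2 * qconst qI + chi i c3 * qconst qJ + chi i c4 * qconst qK"
    using gen_R_mem[of i] by (simp add: eqv_def gen_R_def algebra_simps del: chi.simps)
qed (intro reducible_add reducible_mult reducible_chi reducible_qconst)

lemma reducible_ltrs: "ltrs i \<in> reducible"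
proof -
  \<comment> \<open>This is the definition of \<open>chi i c1\<close> solved for
    \<open>ltrs i\<close>, an exact equation and not only a congruence.\<close>
  have "ltrs i = 2 *\<^sub>R chi i c1 + (- 1) *\<^sub>R ltr i"
    by simp
  then show ?thesis
    by (simp only: reducible_add reducible_scaleR reducible_chi reducible_ltr)
qed

lemma all_reducible: "x \<in> reducible"
  by (induction x rule: qalg_induct)
    (simp_all add: reducible_qconst reducible_ltr reducible_ltrs reducible_add reducible_mult)

lemma scalar_identity_ideal_subset:
  assumes "I \<subseteq> scalar_identity_ideal"
  shows "scalar_identity_ideal \<subseteq> I"
proof
  fix x :: "'n qalg"
  assume x: "x \<in> scalar_identity_ideal"
  obtain p where p: "x - rho_section p \<in> I"
    using all_reducible[of x] by (auto simp: reducible_def eqv_def)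
  \<comment> \<open>As \<open>I\<close> lies in the kernel, \<open>rho\<close> turns the congruence
    into an equation.\<close>
  then have "rho x - rho (rho_section p) = 0"
    using assms by (auto simp: scalar_identity_ideal_iff simp flip: rho_diff)
  then have "p = 0"
    using x by (simp add: scalar_identity_ideal_iff rho_rho_section)
  then show "x \<in> I" using p by simp
qed

end

theorem lemma4p3:
  shows "(scalar_identity_ideal :: 'n::finite qalg set) =
      star_ideal_gen ({gen_C i j u | i j u. u \<in> {qI, qJ, qK}}
        \<union> {gen_D i j k l | i j k l. True} \<union> {gen_R i | i. True})
    \<and> (\<exists>\<phi> \<in> ring_iso (ring_of_type_algebra Quot (scalar_identity_ideal :: 'n qalg set))
               (ring_of_type_algebra :: 'n qpoly ring).
         (\<forall>a. \<phi> (scalar_identity_ideal +>\<^bsub>ring_of_type_algebra\<^esub> qconst a) = pconst a)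
       \<and> (\<forall>x. \<phi> (scalar_identity_ideal +>\<^bsub>ring_of_type_algebra\<^esub> star x)
             = pstar (\<phi> (scalar_identity_ideal +>\<^bsub>ring_of_type_algebra\<^esub> x))))"
proof
  let ?G = "{gen_C i j u | i j u. u \<in> {qI, qJ, qK}}
    \<union> {gen_D i j k l | i j k l. True} \<union> {gen_R i | i. True} :: 'n qalg set"
  let ?K = "scalar_identity_ideal :: 'n qalg set"
  have "?G \<subseteq> ?K"
    by (auto simp: scalar_identity_ideal_iff rho_gen_C rho_gen_D rho_gen_R)
  then have K: "?K \<in> {I. ideal I ring_of_type_algebra \<and> star ` I \<subseteq> I \<and> ?G \<subseteq> I}"
    using ideal_scalar_identity_ideal star_scalar_identity_ideal by blast
  \<comment> \<open>The kernel is least among all two-sided ideals through the generators, in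
    particular among the star-closed ones.\<close>
  have "?K \<subseteq> I" if I: "ideal I ring_of_type_algebra" "?G \<subseteq> I" for I
  proof -
    \<comment> \<open>Intersecting with the kernel meets the assumption of
      \<open>scalar_identity_ideal_subset\<close> and keeps the generators.\<close>
    have int: "ideal (I \<inter> ?K) ring_of_type_algebra"
      using I(1) ideal_scalar_identity_ideal unfolding ideal_ring_of_type_algebra_iff by blast
    have G: "?G \<subseteq> I \<inter> ?K"
      using I(2) \<open>?G \<subseteq> ?K\<close> by (rule Int_greatest)
    interpret generated_ideal "I \<inter> ?K"
    proof (rule generated_ideal.intro[OF int])
      show "gen_C i j u \<in> I \<inter> ?K" if "u \<in> {qI, qJ, qK}" for i j u
        by (rule subsetD[OF G]) (use that in blast)
      show "gen_D i j k l \<in> I \<inter> ?K" for i j k l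
        by (rule subsetD[OF G]) blast
      show "gen_R i \<in> I \<inter> ?K" for i
        by (rule subsetD[OF G]) blast
    qed
    show ?thesis using scalar_identity_ideal_subset by blast
  qed
  then show "?K = star_ideal_gen ?G"
    unfolding star_ideal_gen_def using K by blast

  interpret rho: ring_hom_ring ring_of_type_algebra ring_of_type_algebra
    "rho :: 'n qalg \<Rightarrow> 'n qpoly" by (rule ring_hom_ring_rho)
  \<comment> \<open>On a coset of its kernel \<open>rho\<close> is constant, so the image is a
    singleton; \<open>?\<phi>\<close> is the induced map of the first isomorphism theorem.\<close>
  let ?\<phi> = "\<lambda>A. the_elem ((rho :: 'n qalg \<Rightarrow> 'n qpoly) ` A)"
  \<comment> \<open>The section is a right inverse of \<open>rho\<close>.\<close>
  have "surj (rho :: 'n qalg \<Rightarrow> 'n qpoly)"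
    by (metis rho_rho_section surjI)
  then have "?\<phi> \<in> ring_iso (ring_of_type_algebra Quot ?K) ring_of_type_algebra"
    unfolding scalar_identity_ideal_def by (intro rho.FactRing_iso_set) simp
  moreover have "?\<phi> (?K +>\<^bsub>ring_of_type_algebra\<^esub> x) = rho x" for x
    unfolding scalar_identity_ideal_def by (rule rho.the_elem_simp) simp
  ultimately show "\<exists>\<phi> \<in> ring_iso (ring_of_type_algebra Quot ?K)
               (ring_of_type_algebra :: 'n qpoly ring).
         (\<forall>a. \<phi> (?K +>\<^bsub>ring_of_type_algebra\<^esub> qconst a) = pconst a)
       \<and> (\<forall>x. \<phi> (?K +>\<^bsub>ring_of_type_algebra\<^esub> star x)
             = pstar (\<phi> (?K +>\<^bsub>ring_of_type_algebra\<^esub> x)))"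
    by (intro bexI[of _ ?\<phi>]) (simp_all add: rho_simps rho_star)
qed

end
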